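(* Let $a$ be a real number with $0<a<1$, and let $(b_k)_{k\ge 0}$ be a sequence of real numbers and $(c_k)_{k\geq 0}$ a sequence with $c_k\in\{0,1\}$ for all $k$ and $c_0=1$, such that the identity of formal power series $$(x^5+ax^2+1)\left(\sum_{k=0}^{\infty} b_kx^k\right)=\sum_{k=0}^\infty c_kx^k$$ holds. Let $N=\min\{n\ge 4: c_n=0\}$ if this set is nonempty, and $N=\infty$ if $c_n=1$ for all $n\ge 4$. Then there is a natural number $n$ such that $b_n<0$ and $n\le N+8$.
   Context: When $N=\infty$, the condition $n\le N+8$ is vacuous. *)

theory Defs
  imports
    "HOL-Computational_Algebra.Formal_Power_Series"
    "HOL-Library.Extended_Nat"
begin

definition first_zero_ge4 :: "(nat \<Rightarrow> real) \<Rightarrow> enat" where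
  "first_zero_ge4 c =
     (if \<exists>n\<ge>4. c n = 0 then enat (LEAST n. n \<ge> 4 \<and> c n = 0) else \<infinity>)"

end

theory Submission
  imports Defs
begin

text \<open>
  Suppose \<open>b\<close> stays nonnegative up to \<open>N + 8\<close>. The first few coefficients force \<open>c\<close> to begin
  with \<open>1, 0, 1, 0, 1, 1\<close>, so up to \<open>N\<close> the sequence \<open>b\<close> depends on \<open>a\<close> alone: it is
  \<open>t\<^sub>k = 1 - a t\<^sub>k\<^sub>-\<^sub>2 - t\<^sub>k\<^sub>-\<^sub>5\<close>, started with the alternating values \<open>1, 0, 1, 0, 1\<close> four places
  earlier (\<open>t\<close> is \<open>tail a\<close> below). As \<open>c\<^sub>N = 0\<close>, nonnegativity at \<open>N\<close> forces \<open>b\<^sub>N\<^sub>-\<^sub>2 = b\<^sub>N\<^sub>-\<^sub>5 = 0\<close>, and nonnegativity at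
  \<open>N + 1, \<dots>, N + 8\<close>, whatever the later \<open>c\<^sub>k\<close>, then yields one of
  \<open>2 b\<^sub>N\<^sub>-\<^sub>4 \<le> 1 + a - 3 a b\<^sub>N\<^sub>-\<^sub>1\<close> and \<open>b\<^sub>N\<^sub>-\<^sub>4 + a b\<^sub>N\<^sub>-\<^sub>1 \<ge> 1\<close>. Both fail for the sequence \<open>t\<close>.

  For \<open>a \<le> 7/100\<close> this is seen from the modes of \<open>t\<close>. Two of the roots of \<open>x\<^sup>5 + a x\<^sup>2 + 1\<close> lie
  inside the unit circle and three outside. The two growing modes start with amplitude \<open>O(a)\<close>, so
  by the time \<open>t\<close> can reach a double zero the mode of the real root, which started with amplitude
  about \<open>1/2\<close>, has shrunk to \<open>O(a)\<close>; the third pair is \<open>O(a)\<close> throughout. A double zero is thus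
  made almost entirely by the growing pair, and this determines \<open>b\<^sub>N\<^sub>-\<^sub>4\<close> up to \<open>O(a)\<close>; it is about
  \<open>0.81\<close>. The same growing pair makes \<open>t\<close> negative eventually. For \<open>7/100 \<le> a \<le> 1/2\<close> the sequence
  becomes negative within a few hundred steps and interval arithmetic suffices; for \<open>a > 1/2\<close>
  already \<open>t\<^sub>1\<^sub>3 = a - 2 a\<^sup>2\<close> is negative.
\<close>

section \<open>Interval arithmetic for \<open>a\<close> away from zero\<close>

fun tail :: "real \<Rightarrow> nat \<Rightarrow> real" where
  "tail a 0 = 1"
| "tail a (Suc 0) = 0"
| "tail a (Suc (Suc 0)) = 1"
| "tail a (Suc (Suc (Suc 0))) = 0"
| "tail a (Suc (Suc (Suc (Suc 0)))) = 1"
| "tail a (Suc (Suc (Suc (Suc (Suc n))))) = 1 - a * tail a (Suc (Suc (Suc n))) - tail a n"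

text \<open>With \<open>K = N + 4\<close> the indices \<open>K - 2\<close>, \<open>K - 5\<close>,
  \<open>K - 4\<close>, \<open>K - 1\<close> are those of \<open>b\<close> at \<open>N - 2\<close>,
  \<open>N - 5\<close>, \<open>N - 4\<close>, \<open>N - 1\<close>. The conclusion negates the two
  alternatives that nonnegativity beyond \<open>N\<close> would force.\<close>

definition separated :: "real \<Rightarrow> nat \<Rightarrow> bool" where
  "separated a K \<longleftrightarrow> (tail a (K - 2) = 0 \<longrightarrow> tail a (K - 5) = 0 \<longrightarrow>
     1 + a < 2 * tail a (K - 4) + 3 * a * tail a (K - 1) \<and> tail a (K - 4) + a * tail a (K - 1) < 1)"

lemma tail_rec: "5 \<le> k \<Longrightarrow> tail a k = 1 - a * tail a (k - 2) - tail a (k - 5)"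
proof -
  assume "5 \<le> k"
  then obtain n where "k = Suc (Suc (Suc (Suc (Suc n))))"
    by (auto simp: le_iff_add numeral_eq_Suc)
  then show ?thesis by simp
qed

text \<open>
  Fixed-point interval arithmetic: \<open>l\<^sub>i\<close> and \<open>h\<^sub>i\<close> enclose \<open>2\<^sup>1\<^sup>6 t\<^sub>K\<^sub>-\<^sub>i\<close> for all \<open>a\<close> between
  \<open>A / 2\<^sup>1\<^sup>3\<close> and \<open>B / 2\<^sup>1\<^sup>3\<close>. The enclosures may be clipped to \<open>[0, 2\<^sup>1\<^sup>6]\<close>, which
  keeps them narrow, because the claim is trivial once a term is negative.
\<close>

primrec sweep :: "nat \<Rightarrow> int \<Rightarrow> int \<Rightarrow> int \<Rightarrow> int \<Rightarrow> int \<Rightarrow> int \<Rightarrow> int \<Rightarrow> int \<Rightarrow> int \<Rightarrow> int \<Rightarrow> int \<Rightarrow> int \<Rightarrow> bool" where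
  "sweep 0 A B l1 l2 l3 l4 l5 h1 h2 h3 h4 h5 = False"
| "sweep (Suc n) A B l1 l2 l3 l4 l5 h1 h2 h3 h4 h5 =
    (if 0 < l2 \<or> 0 < l5 \<or>
        65536 + 8 * B < 2 * l4 + 3 * drop_bit 13 (A * l1) \<and> h4 + drop_bit 13 (B * h1) + 1 < 65536
     then let hi = 65536 - drop_bit 13 (A * l2) - l5 in
       if hi < 0 then True
       else sweep n A B (max (65535 - drop_bit 13 (B * h2) - h5) 0) l1 l2 l3 l4 (min hi 65536) h1 h2 h3 h4
     else False)"

text \<open>The guard on earlier terms makes this inductive: given \<open>separated a K\<close>, it
  holds at \<open>K\<close> as soon as \<open>tail a K < 0\<close> or it holds at
  \<open>Suc K\<close>.\<close>

definition settled :: "real \<Rightarrow> nat \<Rightarrow> bool" where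
  "settled a K \<longleftrightarrow> (\<exists>k. tail a k < 0) \<and>
     (\<forall>K'\<ge>K. (\<forall>k<K'. 0 \<le> tail a k) \<longrightarrow> separated a K')"

lemma drop13:
  fixes m :: int
  shows "of_int (drop_bit 13 m) \<le> (of_int m :: real) / 8192"  "(of_int m :: real) / 8192 < of_int (drop_bit 13 m) + 1"
proof -
  have "drop_bit 13 m = \<lfloor>(of_int m :: real) / 8192\<rfloor>"
    by (simp add: drop_bit_eq_div floor_divide_of_int_eq[of m 8192, symmetric, where ?'a = real, simplified])
  then show "of_int (drop_bit 13 m) \<le> (of_int m :: real) / 8192"  "(of_int m :: real) / 8192 < of_int (drop_bit 13 m) + 1"
    by linarith+
qed

lemma settled_negI:
  assumes "tail a K < 0" "separated a K"
  shows "settled a K"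
  unfolding settled_def
proof (intro conjI allI impI)
  show "\<exists>k. tail a k < 0" using assms(1) by blast
next
  fix K' assume "K \<le> K'" and nn: "\<forall>k<K'. 0 \<le> tail a k"
  then have "K' = K" using assms(1) by (metis le_neq_implies_less not_less)
  then show "separated a K'" using assms by simp
qed

text \<open>Each round certifies \<open>separated a K\<close>, encloses \<open>tail a K\<close> and
  shifts the window. Rounding in \<open>drop_bit\<close> costs less than one unit, hence 65535 in
  the lower end. Clipping is sound: a negative term settles the claim at once, and a nonnegative one
  is at most 1 because the terms before it in the window are nonnegative.\<close>

lemma sweep_sound:
  assumes "sweep n A B l1 l2 l3 l4 l5 h1 h2 h3 h4 h5" "5 \<le> K" "0 \<le> A" "of_int A \<le> 8192 * a" "8192 * a \<le> of_int B"
    "0 \<le> l1" "of_int l1 \<le> 65536 * tail a (K - 1)" "65536 * tail a (K - 1) \<le> of_int h1"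
    "0 \<le> l2" "of_int l2 \<le> 65536 * tail a (K - 2)" "65536 * tail a (K - 2) \<le> of_int h2"
    "0 \<le> l3" "of_int l3 \<le> 65536 * tail a (K - 3)" "65536 * tail a (K - 3) \<le> of_int h3"
    "0 \<le> l4" "of_int l4 \<le> 65536 * tail a (K - 4)" "65536 * tail a (K - 4) \<le> of_int h4"
    "0 \<le> l5" "of_int l5 \<le> 65536 * tail a (K - 5)" "65536 * tail a (K - 5) \<le> of_int h5"
  shows "settled a K"
  using assms
proof (induction n arbitrary: K l1 l2 l3 l4 l5 h1 h2 h3 h4 h5)
  case 0
  then show ?case by simp
next
  case (Suc n)
  let ?hi = "65536 - drop_bit 13 (A * l2) - l5"
  let ?lo = "65535 - drop_bit 13 (B * h2) - h5"
  have A0: "0 \<le> A" "0 \<le> (of_int A :: real)" using Suc.prems by simp_all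
  have a0: "0 \<le> a" using Suc.prems(4) A0 by linarith
  have low: "of_int (drop_bit 13 (A * l)) \<le> 65536 * (a * x)"
    if "0 \<le> l" "of_int l \<le> 65536 * x" for l x
  proof -
    have "of_int A * of_int l \<le> (8192 * a) * (65536 * x)"
      using that Suc.prems(4) A0 by (intro mult_mono) auto
    then show ?thesis using drop13(1)[of "A * l"] by (simp add: field_simps)
  qed
  have high: "65536 * (a * x) < of_int (drop_bit 13 (B * h)) + 1"
    if "0 \<le> x" "65536 * x \<le> of_int h" for h x
  proof -
    have "(8192 * a) * (65536 * x) \<le> of_int B * of_int h"
      using that Suc.prems(5) a0 by (intro mult_mono) auto
    then show ?thesis using drop13(2)[of "B * h"] by (simp add: field_simps)
  qed
  have nn: "0 \<le> tail a (K - 1)" "0 \<le> tail a (K - 2)" "0 \<le> tail a (K - 5)"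
    using Suc.prems(6,7,9,10,18,19) by linarith+
  have cl: "separated a K"
    unfolding separated_def
  proof (intro impI)
    assume z: "tail a (K - 2) = 0" "tail a (K - 5) = 0"
    then have "\<not> 0 < l2" "\<not> 0 < l5" using Suc.prems(10,19) by (simp_all add: z)
    then have t: "65536 + 8 * B < 2 * l4 + 3 * drop_bit 13 (A * l1)" "h4 + drop_bit 13 (B * h1) + 1 < 65536"
      using Suc.prems(1) by (auto split: if_splits)
    \<comment> \<open>Since \<open>8192 * a \<le> B\<close>, the term \<open>8 * B\<close> bounds
      \<open>65536 * a\<close>.\<close>
    have "65536 + 8 * of_int B < 2 * of_int l4 + 3 * (of_int (drop_bit 13 (A * l1)) :: real)"
      using t(1) by linarith
    moreover have "of_int h4 + of_int (drop_bit 13 (B * h1)) + 1 < (65536 :: real)"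
      using t(2) by linarith
    ultimately show "1 + a < 2 * tail a (K - 4) + 3 * a * tail a (K - 1) \<and> tail a (K - 4) + a * tail a (K - 1) < 1"
      using low[OF Suc.prems(6,7)] high[OF nn(1) Suc.prems(8)] Suc.prems(5,16,17) by simp
  qed
  have K: "tail a K = 1 - a * tail a (K - 2) - tail a (K - 5)" using Suc.prems(2) by (rule tail_rec)
  have up: "65536 * tail a K \<le> of_int ?hi"
    using low[OF Suc.prems(9,10)] Suc.prems(19) K by simp
  have dn: "of_int ?lo \<le> 65536 * tail a K"
    using high[OF nn(2) Suc.prems(11)] Suc.prems(20) K by simp
  show ?case
  proof (cases "tail a K < 0")
    case True
    then show ?thesis using cl by (rule settled_negI)
  next
    case False
    have "0 \<le> (of_int ?hi :: real)" using up False by linarith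
    then have hi: "\<not> ?hi < 0" by linarith
    have step: "sweep n A B (max ?lo 0) l1 l2 l3 l4 (min ?hi 65536) h1 h2 h3 h4"
      using Suc.prems(1) hi by (simp only: sweep.simps Let_def split: if_splits)
    have sh: "Suc K - 1 = K" "Suc K - 2 = K - 1" "Suc K - 3 = K - 2" "Suc K - 4 = K - 3" "Suc K - 5 = K - 4"
      by simp_all
    have "0 \<le> a * tail a (K - 2)" using a0 nn(2) by simp
    then have "tail a K \<le> 1" using K nn(3) by linarith
    then have mn: "65536 * tail a K \<le> of_int (min ?hi 65536)"
      using up by (simp only: min_def split: if_splits) simp
    have mx: "of_int (max ?lo 0) \<le> 65536 * tail a K"
      using dn False by (simp only: max_def split: if_splits) simp
    have g: "settled a (Suc K)"
      by (rule Suc.IH[OF step], simp_all only: sh)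
        (use Suc.prems mn mx in \<open>assumption | linarith\<close>)+
    show ?thesis
      using g cl unfolding settled_def by (metis Suc_leI le_neq_implies_less)
  qed
qed

text \<open>Consecutive entries bound \<open>8192 * a\<close>. The 0s and 65536s are the exact
  scaled values of \<open>tail a 4\<close>, ..., \<open>tail a 0\<close>; 400 is fuel.\<close>

fun sweeps :: "int list \<Rightarrow> bool" where
  "sweeps (B # A # xs) \<longleftrightarrow> sweep 400 A B 65536 0 65536 0 65536 65536 0 65536 0 65536 \<and> sweeps (A # xs)"
| "sweeps _ \<longleftrightarrow> True"

lemma sweeps_sound:
  assumes "sweeps (B # xs)" "\<forall>x\<in>set xs. 0 \<le> x" "of_int (last (B # xs)) \<le> 8192 * a" "8192 * a \<le> of_int B" "xs \<noteq> []"
  shows "settled a 5"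
  using assms
proof (induction xs arbitrary: B)
  case Nil
  then show ?case by simp
next
  case (Cons A xs)
  show ?case
  proof (cases "8192 * a \<le> of_int A \<and> xs \<noteq> []")
    case True
    then show ?thesis using Cons by auto
  next
    case False
    then have "of_int A \<le> 8192 * a" using Cons.prems(3) by (auto split: if_splits)
    moreover have "tail a 3 = 0" "tail a 2 = 1" "tail a 4 = 1" by (simp_all add: numeral_eq_Suc)
    ultimately show ?thesis
      using Cons.prems by (intro sweep_sound[of 400 A B 65536 0 65536 0 65536 65536 0 65536 0 65536]) simp_all
  qed
qed

text \<open>The breakpoints were found greedily: each interval is about as wide as \<open>sweep\<close> tolerates.\<close>

lemma sweeps_1: "sweeps
   [4096, 3570, 3331, 3071, 2869, 2765, 2694, 2602, 2491, 2396, 2340, 2307, 2281, 2259, 2240,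
    2222, 2189, 2127, 2077, 2044, 2022, 2008, 2000, 1992, 1983, 1973, 1961, 1948, 1926, 1889,
    1856, 1832, 1811, 1788, 1763, 1736, 1706, 1678, 1649, 1619, 1587, 1555, 1523, 1490, 1461,
    1427, 1393, 1366, 1345, 1314, 1289, 1269, 1252, 1228, 1207, 1190, 1177, 1160, 1142, 1127,
    1115, 1105, 1091, 1077, 1065, 1055, 1047, 1037, 1025, 1015, 1006, 999, 993, 985, 976, 967,
    960, 954, 949, 944, 938, 931, 924, 918, 913, 908, 903, 897, 891, 885]"
  by code_simp

lemma sweeps_2: "sweeps
   [885, 880, 875, 870, 865, 859, 853, 848, 843, 838, 832, 826, 821, 816, 811, 806, 801, 796,
    791, 786, 781, 776, 771, 766, 761, 756, 751, 746, 741, 736, 732, 727, 722, 717, 712, 708,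
    704, 699, 694, 690, 686]"
  by code_simp

lemma sweeps_3: "sweeps
   [686, 682, 678, 674, 670, 667, 664, 661, 657, 653, 650, 647, 644, 641, 637, 634, 631, 628,
    626, 623, 620, 617, 614, 612]"
  by code_simp

lemma sweeps_4: "sweeps
   [612, 610, 608, 606, 603, 600, 598, 596, 594, 592, 590, 588, 585, 583, 581, 579, 577, 575,
    573]"
  by code_simp

text \<open>The lists join at 885, 686 and 612. As 573/8192 is just below 7/100, this range overlaps
  that of small \<open>a\<close>.\<close>

lemma settled_mid:
  assumes "573 \<le> 8192 * a" "8192 * a \<le> 4096"
  shows "settled a 5"
proof -
  consider "885 \<le> 8192 * a" "8192 * a \<le> 4096"
    | "686 \<le> 8192 * a" "8192 * a \<le> 885"
    | "612 \<le> 8192 * a" "8192 * a \<le> 686"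
    | "573 \<le> 8192 * a" "8192 * a \<le> 612"
    using assms by linarith
  then show ?thesis
    by cases (use sweeps_sound[OF sweeps_1, of a] sweeps_sound[OF sweeps_2, of a]
      sweeps_sound[OF sweeps_3, of a] sweeps_sound[OF sweeps_4, of a] in simp_all)
qed

section \<open>Modes of the sequence for small \<open>a\<close>\<close>

text \<open>\<open>1 / (2 + a)\<close> is the fixed point of the recurrence, so the deviation
  satisfies the homogeneous one.\<close>

definition dev :: "real \<Rightarrow> nat \<Rightarrow> real" where "dev a k = tail a k - 1 / (2 + a)"

lemma dev_rec:
  assumes "0 < a"
  shows "dev a (k + 5) = - a * dev a (k + 3) - dev a k"
proof -
  have "1 - 1 / (2 + a) = a * (1 / (2 + a)) + 1 / (2 + a)" using assms by (simp add: field_simps)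
  then show ?thesis using tail_rec[of "k + 5" a] by (simp add: dev_def algebra_simps)
qed

lemma dev_init:
  "dev a 0 = 1 - 1 / (2 + a)" "dev a 1 = - 1 / (2 + a)" "dev a 2 = 1 - 1 / (2 + a)"
  "dev a 3 = - 1 / (2 + a)" "dev a 4 = 1 - 1 / (2 + a)"
  by (simp_all add: dev_def numeral_eq_Suc)

text \<open>
  The filter with symbol \<open>(x\<^sup>5 + a x\<^sup>2 + 1) / (1 - S x + b x\<^sup>2)\<close>. When the division is exact it
  removes from \<open>dev\<close> every mode except the pair belonging to \<open>1 - S x + b x\<^sup>2\<close>.
\<close>

definition pair_mode :: "real \<Rightarrow> real \<Rightarrow> real \<Rightarrow> nat \<Rightarrow> real" where
  "pair_mode a S b n = dev a (n + 3) + S * dev a (n + 2) + (a + S\<^sup>2 - b) * dev a (n + 1) + dev a n / b"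

text \<open>With \<open>q = a + S\<^sup>2 - b\<close>, the last two hypotheses say that the
  coefficients of x^3 and x^4 in (1 - S x + b x^2)(1 + S x + q x^2 + x^3 / b) vanish. The product is
  then x^5 + a x^2 + 1, which annihilates \<open>dev\<close>.\<close>

lemma pair_mode_rec:
  assumes "0 < a" "b \<noteq> 0" "1 / b = S * (a + S\<^sup>2 - b) - b * S" "S / b = b * (a + S\<^sup>2 - b)"
  shows "pair_mode a S b (n + 2) = S * pair_mode a S b (n + 1) - b * pair_mode a S b n"
proof -
  define q r where "q = a + S\<^sup>2 - b" and "r = 1 / b"
  have 1: "a = q - S\<^sup>2 + b" "r = S * q - b * S" "S * r = b * q" "b * r = 1"
    subgoal by (simp add: q_def)
    subgoal using assms(3) by (simp add: q_def r_def)
    subgoal using assms(4) by (simp add: q_def r_def)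
    subgoal using assms(2) by (simp add: r_def)
    done
  have e: "pair_mode a S b m = dev a (m + 3) + S * dev a (m + 2) + q * dev a (m + 1) + r * dev a m" for m
    by (simp add: pair_mode_def q_def r_def)
  have 2: "dev a (n + 2 + 3) = - a * dev a (n + 3) - dev a n" using dev_rec[OF assms(1), of n] by (simp add: add.commute)
  have "pair_mode a S b (n + 2) - S * pair_mode a S b (n + 1) + b * pair_mode a S b n
      = dev a (n + 2 + 3) + (q - S\<^sup>2 + b) * dev a (n + 3) + (r - S * q + b * S) * dev a (n + 2)
        + (b * q - S * r) * dev a (n + 1) + (b * r) * dev a n"
    unfolding e by (simp add: algebra_simps power2_eq_square numeral_eq_Suc)
  also have "\<dots> = 0" unfolding 2 1(3,4) by (simp flip: 1(1) add: 1(2))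
  finally show ?thesis by simp
qed

text \<open>The recurrence multiplies this quadratic form by \<open>b\<close> at each step. Its
  initial value follows from the factorization at x = 1 and x = -1, because the starting values
  alternate; being of order \<open>a\<^sup>2\<close>, it makes the initial amplitude O(a).\<close>

lemma pair_mode_energy:
  assumes "0 < a" "b \<noteq> 0" "1 / b = S * (a + S\<^sup>2 - b) - b * S" "S / b = b * (a + S\<^sup>2 - b)"
    and nz: "1 + S + b \<noteq> 0" "1 - S + b \<noteq> 0"
  shows "(pair_mode a S b (n + 1))\<^sup>2 - S * pair_mode a S b (n + 1) * pair_mode a S b n + b * (pair_mode a S b n)\<^sup>2
    = b ^ n * a\<^sup>2 / ((1 + b)\<^sup>2 - S\<^sup>2)"
proof (induction n)
  case 0
  define q r h where "q = a + S\<^sup>2 - b" and "r = 1 / b" and "h = 1 / (2 + a)"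
  define x y U V where "x = pair_mode a S b 1" and "y = pair_mode a S b 0" and "U = 1 - S + b" and "V = 1 + S + b"
  have qr: "a = q - S\<^sup>2 + b" "r = S * q - b * S" "S * r = b * q" "b * r = 1"
    subgoal by (simp add: q_def)
    subgoal using assms(3) by (simp add: q_def r_def)
    subgoal using assms(4) by (simp add: q_def r_def)
    subgoal using assms(2) by (simp add: r_def)
    done
  have UV: "U \<noteq> 0" "V \<noteq> 0" using nz by (simp_all add: U_def V_def)
  have h: "(2 + a) * h = 1" using assms(1) by (simp add: h_def)
  have e: "pair_mode a S b m = dev a (m + 3) + S * dev a (m + 2) + q * dev a (m + 1) + r * dev a m" for m
    by (simp add: pair_mode_def q_def r_def)
  have d: "dev a 0 = 1 - h" "dev a (Suc 0) = - h" "dev a 2 = 1 - h" "dev a 3 = - h" "dev a 4 = 1 - h"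
    using dev_init[of a] by (simp_all add: h_def)
  have x: "x = (1 - h) * (1 + q) - h * (S + r)" and y: "y = (1 - h) * (S + r) - h * (1 + q)"
    unfolding x_def y_def e by (simp_all add: d d(3)[unfolded numeral_2_eq_2] d(4)[unfolded numeral_3_eq_3] algebra_simps)
  have "U * (1 + q + S + r) = 2 + (q - S\<^sup>2 + b) + (r - S * q + b * S) + (b * q - S * r) + (b * r - 1)"
    by (simp add: U_def algebra_simps power2_eq_square)
  also have "\<dots> = 2 + a" using qr by simp
  finally have "(1 - 2 * h) * (U * (1 + q + S + r)) = (1 - 2 * h) * (2 + a)" by (rule arg_cong)
  also have "\<dots> = a" using h by (simp add: algebra_simps)
  finally have s: "U * (x + y) = a" by (simp add: x y algebra_simps)
  have "V * (1 + q - S - r) = (q - S\<^sup>2 + b) - (r - S * q + b * S) + (b * q - S * r) + (1 - b * r)"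
    by (simp add: V_def algebra_simps power2_eq_square)
  also have "\<dots> = a" using qr by simp
  finally have t: "V * (x - y) = a" by (simp add: x y algebra_simps)
  \<comment> \<open>In the coordinates x + y and x - y the form has coefficients U/4, V/4 and (1 -
    b)/2. After scaling by U V the weights V/4, U/4 and (1 - b)/2 add up to 1.\<close>
  have "(x\<^sup>2 - S * x * y + b * y\<^sup>2) * (U * V) =
     (U * (x + y))\<^sup>2 * V / 4 + (V * (x - y))\<^sup>2 * U / 4 + (1 - b) / 2 * (U * (x + y)) * (V * (x - y))"
    by (simp add: U_def V_def field_simps power2_eq_square)
  also have "\<dots> = a\<^sup>2" unfolding s t by (simp add: U_def V_def field_simps power2_eq_square)
  finally have "(x\<^sup>2 - S * x * y + b * y\<^sup>2) * (U * V) = a\<^sup>2" .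
  moreover have "(1 + b)\<^sup>2 - S\<^sup>2 = U * V" by (simp add: U_def V_def algebra_simps power2_eq_square)
  ultimately show ?case using UV by (simp add: x_def y_def field_simps)
next
  case (Suc n)
  have r: "pair_mode a S b (Suc (n + 1)) = S * pair_mode a S b (n + 1) - b * pair_mode a S b n"
    using pair_mode_rec[OF assms(1-4), of n] by simp
  have "(pair_mode a S b (Suc (n + 1)))\<^sup>2 - S * pair_mode a S b (Suc (n + 1)) * pair_mode a S b (n + 1) + b * (pair_mode a S b (n + 1))\<^sup>2
     = b * ((pair_mode a S b (n + 1))\<^sup>2 - S * pair_mode a S b (n + 1) * pair_mode a S b n + b * (pair_mode a S b n)\<^sup>2)"
    unfolding r by (simp add: algebra_simps power2_eq_square)
  then show ?case using Suc.IH by simp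
qed

section \<open>Factorization of x^5 + a x^2 + 1 for small \<open>a\<close>\<close>

text \<open>
  Comparing coefficients, \<open>1 - S x + b x\<^sup>2\<close> divides \<open>x\<^sup>5 + a x\<^sup>2 + 1\<close> for some \<open>a\<close> iff
  \<open>S\<^sup>2 = b\<^sup>3 S + b\<close>, so this one-parameter family can be solved for \<open>S\<close> and then for \<open>a\<close>.
\<close>

lemma quadratic_factor_exists:
  assumes "0 < a" "a \<le> 7/100"
  obtains b S :: real where "1 < b" "b \<le> 103/100" "S\<^sup>2 = b^3 * S + b" "- 6181/10000 \<le> S" "S \<le> - 605/1000"
    "a * b\<^sup>2 = - S * (b^5 - 1)"
proof -
  \<comment> \<open>The negative root of \<open>S\<^sup>2 = b^3 * S + b\<close>.\<close>
  define s where "s b = (b^3 - sqrt (b^6 + 4 * b)) / 2" for b :: real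
  have s2: "(s b)\<^sup>2 = b^3 * s b + b" and neg: "s b < 0" if "1 \<le> b" for b
  proof -
    have "0 \<le> b^6 + 4 * b" using that by simp
    then have q: "sqrt (b^6 + 4 * b) * sqrt (b^6 + 4 * b) = b^6 + 4 * b" by simp
    show "(s b)\<^sup>2 = b^3 * s b + b"
      using q by (simp add: s_def power2_eq_square field_simps flip: power_add)
    have "b^3 < sqrt (b^6 + 4 * b)"
      using that by (intro real_less_rsqrt) (simp flip: power_mult)
    then show "s b < 0" by (simp add: s_def)
  qed
  have lo: "- 6181/10000 \<le> s b" and up: "s b \<le> - 605/1000" if b: "1 \<le> b" "b \<le> 103/100" for b
  proof -
    have g: "(s b)\<^sup>2 - b^3 * s b - b = 0" using s2[OF b(1)] by simp
    \<comment> \<open>Tangent of the cube at 1, and its chord over [1, 103/100].\<close>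
    have b3: "3 * b - 2 \<le> b^3" "10000 * b^3 \<le> 30909 * b - 20909"
    proof -
      define X where "X = (b - 1) * (b\<^sup>2 + b + 1)"
      have X: "b^3 = 1 + X" by (simp add: X_def algebra_simps power2_eq_square power3_eq_cube)
      have "1 \<le> b\<^sup>2" using b(1) by (rule one_le_power)
      then have "3 \<le> b\<^sup>2 + b + 1" using b(1) by linarith
      then have lo: "(b - 1) * 3 \<le> X"
        unfolding X_def by (rule mult_left_mono) (use b in simp)
      have "b\<^sup>2 \<le> (103/100)\<^sup>2" using b by (intro power_mono) auto
      then have "X \<le> (b - 1) * (30909/10000)"
        unfolding X_def using b by (intro mult_left_mono) (auto simp: power2_eq_square)
      with lo X show "3 * b - 2 \<le> b^3" "10000 * b^3 \<le> 30909 * b - 20909" by auto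
    qed
    \<comment> \<open>The sign of the quadratic at \<open>c\<close> tells on which side of
      \<open>c\<close> its root \<open>s b\<close> lies. The value -6181/10000 is just below (1 -
      sqrt 5)/2, the root for \<open>b = 1\<close>.\<close>
    have factor: "((s b)\<^sup>2 - b^3 * s b - b) - (c\<^sup>2 - b^3 * c - b) = (s b - c) * (s b + c - b^3)" for c
      by (simp add: algebra_simps power2_eq_square)
    show "- 6181/10000 \<le> s b"
    proof (rule ccontr)
      assume "\<not> ?thesis"
      then have "0 < (s b - (- 6181/10000)) * (s b + (- 6181/10000) - b^3)"
        using b3 b by (intro mult_neg_neg) auto
      then have "(- 6181/10000)\<^sup>2 - b^3 * (- 6181/10000) - b < 0"
        using factor[of "- 6181/10000"] g by linarith
      then show False using b3(1) b by (simp add: power2_eq_square field_simps)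
    qed
    show "s b \<le> - 605/1000"
    proof (rule ccontr)
      assume "\<not> ?thesis"
      then have "(s b - (- 605/1000)) * (s b + (- 605/1000) - b^3) < 0"
        using b3 b neg[OF b(1)] by (intro mult_pos_neg) auto
      then have "0 < (- 605/1000)\<^sup>2 - b^3 * (- 605/1000) - b"
        using factor[of "- 605/1000"] g by linarith
      then show False using b3(2) b by (simp add: power2_eq_square field_simps)
    qed
  qed
  let ?f = "\<lambda>b. - s b * (b^5 - 1) / b\<^sup>2"
  have "7/100 \<le> (605/1000) * ((103/100)^5 - 1) / (103/100 :: real)\<^sup>2" by (simp add: power_divide)
  also have "\<dots> \<le> ?f (103/100)"
    using up[of "103/100"] by (intro divide_right_mono mult_right_mono) (auto simp: power_divide)
  finally have f1: "a \<le> ?f (103/100)" using assms by linarith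
  have "continuous_on {1..103/100} ?f" unfolding s_def by (intro continuous_intros) auto
  then obtain b where b: "1 \<le> b" "b \<le> 103/100" "?f b = a"
    using IVT'[of ?f 1 a "103/100"] f1 assms by auto
  have "b \<noteq> 1" using b(3) assms by auto
  show ?thesis
  proof (rule that[of b "s b"])
    show "a * b\<^sup>2 = - s b * (b^5 - 1)" using b by (auto simp: field_simps)
  qed (use b \<open>b \<noteq> 1\<close> s2 lo up in auto)
qed

text \<open>The real root is \<open>-\<rho>\<close>. The sign change is located between sqrt b and
  \<open>b\<close>: at sqrt b use b^5 - 1 = (x^5 + 1)(x^5 - 1) with x = sqrt b and
  \<open>- S * 2 \<ge> 121/100 > b\<close>; at \<open>b\<close> use
  \<open>- S \<le> 1\<close>.\<close>

lemma real_root_exists: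
  fixes a b S :: real
  assumes "0 < a" "1 < b" "b \<le> 103/100" "S \<le> - 605/1000" "- 1 \<le> S" "a * b\<^sup>2 = - S * (b^5 - 1)"
  obtains \<rho> where "1 \<le> \<rho>" "b \<le> \<rho>\<^sup>2" "\<rho> \<le> b" "\<rho>^5 = 1 + a * \<rho>\<^sup>2"
proof -
  let ?g = "\<lambda>x. 1 + a * x\<^sup>2 - x^5"
  define x where "x = sqrt b"
  have x: "x\<^sup>2 = b" "1 \<le> x" using assms by (simp_all add: x_def)
  have x5: "1 \<le> x^5" using x(2) by (rule one_le_power)
  have "b = x * x" "1 * x \<le> x * x" using x assms by (auto simp: power2_eq_square)
  then have xb: "x \<le> b" by simp
  have "a * b\<^sup>2 = - S * (x^5 + 1) * (x^5 - 1)"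
  proof -
    have "b^5 = x^5 * x^5" unfolding x(1)[symmetric] by (simp flip: power_mult power_add)
    then show ?thesis using assms(6) by (simp add: algebra_simps)
  qed
  moreover have "b * (x^5 - 1) \<le> (- S * (x^5 + 1)) * (x^5 - 1)"
  proof (rule mult_right_mono)
    have "(605/1000) * 2 \<le> - S * (x^5 + 1)" using assms x5 by (intro mult_mono) auto
    then show "b \<le> - S * (x^5 + 1)" using assms by linarith
  qed (use x5 in simp)
  ultimately have "b * (x^5 - 1) \<le> b * (a * b)" by (simp add: power2_eq_square algebra_simps)
  then have g0: "0 \<le> ?g x" using assms x by simp
  have "- S * (b^5 - 1) \<le> 1 * (b^5 - 1)" using assms by (intro mult_right_mono) auto
  then have "?g b \<le> 0" using assms(6) by simp
  moreover have "continuous_on {x..b} ?g" by (intro continuous_intros)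
  ultimately obtain \<rho> where r: "x \<le> \<rho>" "\<rho> \<le> b" "?g \<rho> = 0"
    using IVT2'[of ?g b 0 x] g0 xb by auto
  have "x\<^sup>2 \<le> \<rho>\<^sup>2" using r x by (intro power_mono) auto
  then show ?thesis using that[of \<rho>] r x by auto
qed

text \<open>
  The remaining cubic factor splits as \<open>(1 + x / \<rho>) (1 - S' x + b' x\<^sup>2)\<close>.
\<close>

lemma cofactor_relations:
  fixes a b S \<rho> :: real
  assumes S2: "S\<^sup>2 = b^3 * S + b" and ab: "a * b\<^sup>2 = - S * (b^5 - 1)"
    and b: "1 < b" and S: "- 1 \<le> S" "S \<le> 0"
    and rho: "1 \<le> \<rho>" "\<rho>^5 = 1 + a * \<rho>\<^sup>2"
  defines "S' \<equiv> 1 / \<rho> - S" and "b' \<equiv> \<rho> / b"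
  shows "a + S\<^sup>2 - b = S / b\<^sup>2" "a + S'\<^sup>2 - b' = b - S / \<rho>" "1 / b' = b / \<rho>"
    "1 / b = S * (a + S\<^sup>2 - b) - b * S" "S / b = b * (a + S\<^sup>2 - b)"
    "1 / b' = S' * (a + S'\<^sup>2 - b') - b' * S'" "S' / b' = b' * (a + S'\<^sup>2 - b')"
    "b + b' + S * S' = \<rho>^3" "S * b' + S' * b = \<rho>\<^sup>2"
proof -
  define i q c where "i = 1 / \<rho>" and "q = S / b\<^sup>2" and "c = 1 / b"
  have i: "i * \<rho> = 1" and c: "c * b = 1" and r0: "\<rho> \<noteq> 0" and b0: "b \<noteq> 0"
    using b rho by (auto simp: i_def c_def)
  have q: "q = c * c * S" by (simp add: q_def c_def power2_eq_square)
  have "(a + S\<^sup>2 - b) * b\<^sup>2 = S"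
    unfolding S2 distrib_right left_diff_distrib ab by (simp add: algebra_simps flip: power_Suc power_add)
  then show g1: "a + S\<^sup>2 - b = S / b\<^sup>2" using b0 by (simp add: field_simps)
  then have a: "a = q + b - S\<^sup>2" by (simp add: q_def)
  have Sq: "S * q = c + b * S" using arg_cong[OF S2, of "\<lambda>x. c * c * x"] c b0
    by (simp add: q_def c_def field_simps power2_eq_square power3_eq_cube)
  then show g4: "1 / b = S * (a + S\<^sup>2 - b) - b * S" unfolding g1 by (simp add: q_def c_def)
  show g5: "S / b = b * (a + S\<^sup>2 - b)" unfolding g1 using b0 by (simp add: power2_eq_square)
  \<comment> \<open>The quadratic factor does not vanish at \<open>-\<rho>\<close>, so the cubic
    cofactor does.\<close>
  have quad: "0 < 1 + S * \<rho> + b * \<rho>\<^sup>2"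
  proof -
    have "S * \<rho> \<ge> - \<rho>" using S(1) rho(1) mult_right_mono[of "-1" S \<rho>] by simp
    moreover have "\<rho> * 1 \<le> \<rho> * \<rho>" using rho(1) by (intro mult_left_mono) auto
    moreover have "1 * \<rho>\<^sup>2 \<le> b * \<rho>\<^sup>2" using b by (intro mult_right_mono) auto
    ultimately show ?thesis by (simp add: power2_eq_square)
  qed
  have "(1 + S * \<rho> + b * \<rho>\<^sup>2) * (1 - S * \<rho> + q * \<rho>\<^sup>2 - c * \<rho>^3)
     = 1 + (q + b - S\<^sup>2) * \<rho>\<^sup>2 - \<rho>^5 * (c * b) + \<rho>^3 * (S * q - c - b * S) + \<rho>^4 * (b * q - S * c)"
    by (simp add: algebra_simps power2_eq_square numeral_eq_Suc)
  also have "b * q - S * c = 0"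
    using arg_cong[OF c, of "\<lambda>x. c * S * x"] by (simp add: q algebra_simps)
  also have "S * q - c - b * S = 0" using Sq by simp
  finally have "1 - S * \<rho> + q * \<rho>\<^sup>2 - c * \<rho>^3 = 0"
    using quad rho(2) a c by simp
  then have "i * i * (1 - S * \<rho> + q * \<rho>\<^sup>2 - c * \<rho>^3) = 0" by simp
  then have cub: "q = c * \<rho> - i * i + S * i"
    using r0 by (simp add: i_def field_simps power2_eq_square power3_eq_cube)
  have S': "S' = i - S" and b': "b' = \<rho> * c" by (simp_all add: S'_def b'_def i_def c_def)
  show g2: "a + S'\<^sup>2 - b' = b - S / \<rho>"
    unfolding a S' b' using cub by (simp add: i_def algebra_simps power2_eq_square)
  show g3: "1 / b' = b / \<rho>" by (simp add: b'_def)
  have bi: "b * i = S' * (b - S * i) - b' * S'"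
  proof -
    have "S' * (b - S * i) - b' * S' = b * i + S * (c * \<rho> - i * i + S * i) - b * S - c * (i * \<rho>)"
      unfolding S' b' by (simp add: algebra_simps)
    also have "\<dots> = b * i" unfolding cub[symmetric] i using Sq by simp
    finally show ?thesis ..
  qed
  show "1 / b' = S' * (a + S'\<^sup>2 - b') - b' * S'" unfolding g2 g3 using bi by (simp add: i_def)
  have "S' * (b * i) = b' * (b - S * i)"
  proof -
    have "S' * (b * i) = b * (i * i - S * i)" unfolding S' by (simp add: algebra_simps)
    also have "i * i - S * i = c * \<rho> - q" using cub by simp
    also have "b * (c * \<rho> - q) = (c * b) * \<rho> - (c * b) * (c * S)" by (simp add: q algebra_simps)
    also have "\<dots> = \<rho> * (c * b) - c * S * (i * \<rho>)" unfolding c i by simp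
    also have "\<dots> = b' * (b - S * i)" unfolding b' by (simp add: algebra_simps)
    finally show ?thesis .
  qed
  then show "S' / b' = b' * (a + S'\<^sup>2 - b')" unfolding g2 by (simp add: b'_def i_def)
  have r3: "a + i * i = \<rho>^3"
  proof -
    have "\<rho>\<^sup>2 * (a + i * i) = (\<rho>^5 - 1) + (i * \<rho>) * (i * \<rho>)" unfolding rho(2) by (simp add: algebra_simps power2_eq_square)
    also have "\<dots> = \<rho>\<^sup>2 * \<rho>^3" unfolding i by (simp flip: power_add)
    finally show ?thesis by (subst (asm) mult_left_cancel) (use r0 in auto)
  qed
  \<comment> \<open>This and the next relation match the middle coefficients of (1 - S x + b x^2)(1
    - S' x + b' x^2) with those of the quotient by 1 + x / \<open>\<rho>\<close>.\<close>
  show g8: "b + b' + S * S' = \<rho>^3"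
    unfolding r3[symmetric] a S' b' using cub by (simp add: algebra_simps power2_eq_square)
  have "S * b' + S' * b = i * (b + b' + S * S')"
    using bi unfolding S' by (simp add: algebra_simps)
  also have "\<dots> = i * \<rho> * \<rho>\<^sup>2" unfolding g8 by (simp add: power2_eq_square power3_eq_cube)
  finally show "S * b' + S' * b = \<rho>\<^sup>2" unfolding i by simp
qed

section \<open>Bounds on the separate modes\<close>

text \<open>
  The filter with symbol \<open>(x\<^sup>5 + a x\<^sup>2 + 1) / (1 + x / \<rho>)\<close>, isolating the mode of the real root.
\<close>

definition real_mode :: "real \<Rightarrow> real \<Rightarrow> nat \<Rightarrow> real" where
  "real_mode a \<rho> n = dev a (n + 4) - dev a (n + 3) / \<rho> + \<rho>^3 * dev a (n + 2) - \<rho>\<^sup>2 * dev a (n + 1) + \<rho> * dev a n"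

lemma real_mode_power:
  assumes "0 < a" "1 \<le> \<rho>" "\<rho>^5 = 1 + a * \<rho>\<^sup>2"
  shows "real_mode a \<rho> n = (- 1 / \<rho>) ^ n * real_mode a \<rho> 0"
proof (induction n)
  case 0
  show ?case by simp
next
  case (Suc n)
  define i where "i = 1 / \<rho>"
  have i: "i * \<rho> = 1" using assms by (simp add: i_def)
  have "\<rho>\<^sup>2 * (\<rho>^3 - i * i) = \<rho>^5 - (i * \<rho>) * (i * \<rho>)" by (simp add: algebra_simps power2_eq_square numeral_eq_Suc)
  also have "\<dots> = \<rho>\<^sup>2 * a" unfolding i assms(3) by simp
  finally have a: "a = \<rho>^3 - i * i" using assms(2) by simp
  have e: "real_mode a \<rho> m = dev a (m + 4) - i * dev a (m + 3) + \<rho>^3 * dev a (m + 2) - \<rho>\<^sup>2 * dev a (m + 1) + \<rho> * dev a m" for m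
    by (simp add: real_mode_def i_def)
  have "real_mode a \<rho> (Suc n) + i * real_mode a \<rho> n
     = dev a (n + 5) + (\<rho>^3 - i * i) * dev a (n + 3) + \<rho>\<^sup>2 * (i * \<rho> - 1) * dev a (n + 2)
       - \<rho> * (i * \<rho> - 1) * dev a (n + 1) + (i * \<rho>) * dev a n"
    unfolding e by (simp add: algebra_simps power2_eq_square numeral_eq_Suc)
  also have "\<dots> = 0" unfolding i a[symmetric] using dev_rec[OF assms(1), of n] by simp
  finally have "real_mode a \<rho> (Suc n) = - i * real_mode a \<rho> n" by simp
  then show ?case using Suc.IH by (simp add: i_def)
qed

lemma real_mode_init:
  assumes "0 < a" "a \<le> 7/100" "1 \<le> \<rho>" "\<rho> \<le> 103/100"
  shows "\<bar>real_mode a \<rho> 0\<bar> \<le> 262/100"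
proof -
  define h i where "h = 1 / (2 + a)" and "i = 1 / \<rho>"
  have h: "100/207 \<le> h" "h \<le> 1/2" using assms by (simp_all add: h_def field_simps)
  have i: "0 \<le> i" "i \<le> 1" using assms by (simp_all add: i_def)
  have d: "dev a 0 = 1 - h" "dev a (Suc 0) = - h" "dev a 2 = 1 - h" "dev a 3 = - h" "dev a 4 = 1 - h"
    using dev_init[of a] by (simp_all add: h_def)
  have e: "real_mode a \<rho> 0 = (1 - h) * (1 + \<rho>^3 + \<rho>) + h * (i + \<rho>\<^sup>2)"
    unfolding real_mode_def by (simp add: d d(3)[unfolded numeral_2_eq_2] i_def algebra_simps)
  have "\<rho>^3 \<le> (103/100)^3" "\<rho>\<^sup>2 \<le> (103/100)\<^sup>2" using assms by (intro power_mono; simp)+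
  moreover define P Q where "P = (1 - h) * (1 + \<rho>^3 + \<rho>)" and "Q = h * (i + \<rho>\<^sup>2)"
  ultimately have "P \<le> (1 - h) * (31228/10000)" "Q \<le> h * (20609/10000)"
    unfolding P_def Q_def using h i assms by (intro mult_left_mono; simp add: power_divide)+
  moreover have "0 \<le> P" "0 \<le> Q"
    unfolding P_def Q_def using h i assms by (intro mult_nonneg_nonneg; simp)+
  ultimately show ?thesis unfolding e P_def[symmetric] Q_def[symmetric] using h by (simp add: abs_le_iff)
qed

text \<open>Applied to the decaying pair \<open>S'\<close>, \<open>b'\<close>. After division by
  \<open>(X + S)\<^sup>2\<close> the claim is that a binary quadratic form is nonnegative. The
  factor 33/100, combined with an energy of at most \<open>a\<^sup>2 / (132/100)\<close>, gives
  exactly \<open>(a / 2)\<^sup>2\<close>.\<close>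

lemma mode_form_bound:
  fixes X Y S b \<phi> \<psi> :: real
  assumes "19708/10000 \<le> X" "X \<le> 203/100" "1 \<le> Y" "Y \<le> 103/100"
    "15758/10000 \<le> S" "S \<le> 16181/10000" "985/1000 \<le> b"
  shows "(X * \<phi> - S * Y * \<psi>)\<^sup>2 \<le> 33/100 * (X + S)\<^sup>2 * (\<phi>\<^sup>2 - S * \<phi> * \<psi> + b * \<psi>\<^sup>2)"
proof -
  define t where "t = S / (X + S)"
  have XS: "0 < X + S" using assms by simp
  have t: "43701/100000 \<le> t" "t \<le> 45088/100000"
    using assms XS by (simp_all add: t_def field_simps)
  define c where "c = 1 - t"
  have c: "54912/100000 \<le> c" "c \<le> 56299/100000" using t by (simp_all add: c_def)
  have Yt: "43701/100000 \<le> Y * t" "Y * t \<le> 46441/100000"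
    using mult_mono[OF assms(3) t(1)] mult_mono[OF assms(4) t(2)] assms t by simp_all
  have "c\<^sup>2 \<le> (56299/100000)\<^sup>2" "(Y * t)\<^sup>2 \<le> (46441/100000)\<^sup>2" using c Yt by (intro power_mono; simp)+
  then have AC: "13/1000 \<le> 33/100 - c\<^sup>2" "109/1000 \<le> 33/100 * b - (Y * t)\<^sup>2"
    using assms(7) by (simp_all add: power_divide)
  define m where "m = 2 * (c * (Y * t)) - 33/100 * S"
  have "54912/100000 * (43701/100000) \<le> c * (Y * t)" "c * (Y * t) \<le> 56299/100000 * (46441/100000)"
    using c Yt by (intro mult_mono; simp)+
  then have "\<bar>m\<bar> \<le> 55/1000" using assms unfolding m_def by (intro abs_leI; linarith)
  then have m: "- (55/1000) * (\<bar>\<phi>\<bar> * \<bar>\<psi>\<bar>) \<le> m * (\<phi> * \<psi>)"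
    using mult_right_mono[of "\<bar>m\<bar>" "55/1000" "\<bar>\<phi>\<bar> * \<bar>\<psi>\<bar>"] abs_ge_minus_self[of "m * (\<phi> * \<psi>)"] by (simp add: abs_mult)
  \<comment> \<open>114/1000 and 33/100 approximate the square roots of the diagonal bounds 13/1000
    and 109/1000.\<close>
  have "0 \<le> (\<bar>\<phi>\<bar> * (114/1000) - \<bar>\<psi>\<bar> * (33/100))\<^sup>2" by (rule zero_le_power2)
  also have "\<dots> = 12996/1000000 * \<phi>\<^sup>2 + 1089/10000 * \<psi>\<^sup>2 - 7524/100000 * (\<bar>\<phi>\<bar> * \<bar>\<psi>\<bar>)"
    by (simp add: power2_diff power_mult_distrib power_divide)
  finally have "(55/1000) * (\<bar>\<phi>\<bar> * \<bar>\<psi>\<bar>) \<le> 13/1000 * \<phi>\<^sup>2 + 109/1000 * \<psi>\<^sup>2"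
    using mult_nonneg_nonneg[OF abs_ge_zero abs_ge_zero, of \<phi> \<psi>] zero_le_power2[of \<phi>] zero_le_power2[of \<psi>]
    by linarith
  also have "\<dots> \<le> (33/100 - c\<^sup>2) * \<phi>\<^sup>2 + (33/100 * b - (Y * t)\<^sup>2) * \<psi>\<^sup>2"
    using AC by (intro add_mono mult_right_mono) auto
  finally have "0 \<le> (33/100 - c\<^sup>2) * \<phi>\<^sup>2 + m * (\<phi> * \<psi>) + (33/100 * b - (Y * t)\<^sup>2) * \<psi>\<^sup>2"
    using m by linarith
  also have "\<dots> = 33/100 * (\<phi>\<^sup>2 - S * \<phi> * \<psi> + b * \<psi>\<^sup>2) - (c * \<phi> - Y * t * \<psi>)\<^sup>2"
    by (simp add: m_def algebra_simps power2_eq_square add_divide_distrib diff_divide_distrib)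
  finally have *: "(c * \<phi> - Y * t * \<psi>)\<^sup>2 \<le> 33/100 * (\<phi>\<^sup>2 - S * \<phi> * \<psi> + b * \<psi>\<^sup>2)" by simp
  have "X * \<phi> - S * Y * \<psi> = (X + S) * (c * \<phi> - Y * t * \<psi>)"
  proof -
    have "(X + S) * t = S" using XS by (simp add: t_def)
    moreover from this have "(X + S) * c = X" by (simp add: c_def algebra_simps)
    moreover have "(X + S) * (c * \<phi> - Y * t * \<psi>) = ((X + S) * c) * \<phi> - Y * ((X + S) * t) * \<psi>"
      by (simp add: algebra_simps)
    ultimately show ?thesis by simp
  qed
  then have "(X * \<phi> - S * Y * \<psi>)\<^sup>2 = (X + S)\<^sup>2 * (c * \<phi> - Y * t * \<psi>)\<^sup>2" by (simp add: power_mult_distrib)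
  also have "\<dots> \<le> (X + S)\<^sup>2 * (33/100 * (\<phi>\<^sup>2 - S * \<phi> * \<psi> + b * \<psi>\<^sup>2))" using * by (intro mult_left_mono) auto
  finally show ?thesis by (simp add: algebra_simps)
qed

text \<open>
  The combination \<open>t\<^sub>m - (S\<^sup>2 - b) t\<^sub>m\<^sub>-\<^sub>2 + S b t\<^sub>m\<^sub>-\<^sub>3\<close> vanishes on the growing pair. The pair \<open>S', b'\<close>
  contributes at most \<open>a / 2\<close>. The real mode decays at least as fast as the growing pair \<open>\<eta>\<close> grows,
  since \<open>b \<le> \<rho>\<^sup>2\<close>, so their product stays \<open>O(a)\<close>; this replaces any estimate of the time \<open>m\<close>.
\<close>

lemma modal_bound:
  assumes a: "0 < a" "a \<le> 7/100"
  obtains b S where "1 < b" "b \<le> 103/100" "- 6181/10000 \<le> S" "S \<le> - 605/1000"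
    "a + S\<^sup>2 - b = S / b\<^sup>2"
    "\<And>n. (pair_mode a S b (n + 1))\<^sup>2 - S * pair_mode a S b (n + 1) * pair_mode a S b n + b * (pair_mode a S b n)\<^sup>2
       = b ^ n * a\<^sup>2 / ((1 + b)\<^sup>2 - S\<^sup>2)"
    "\<And>n. \<bar>dev a (n + 4) - (S\<^sup>2 - b) * dev a (n + 2) + S * b * dev a (n + 1)\<bar> * \<bar>pair_mode a S b (n + 1)\<bar>
       \<le> a / 2 * \<bar>pair_mode a S b (n + 1)\<bar> + 327/500 * a"
proof -
  obtain b S where b: "1 < b" "b \<le> 103/100" and S: "- 6181/10000 \<le> S" "S \<le> - 605/1000"
    and S2: "S\<^sup>2 = b^3 * S + b" and ab: "a * b\<^sup>2 = - S * (b^5 - 1)"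
    using quadratic_factor_exists[OF a] by metis
  obtain \<rho> where r: "1 \<le> \<rho>" "b \<le> \<rho>\<^sup>2" "\<rho> \<le> b" and r5: "\<rho>^5 = 1 + a * \<rho>\<^sup>2"
    using real_root_exists[OF a(1) b S(2) _ ab] S by auto
  define i S' b' where "i = 1 / \<rho>" and "S' = 1 / \<rho> - S" and "b' = \<rho> / b"
  have rel: "a + S\<^sup>2 - b = S / b\<^sup>2" "a + S'\<^sup>2 - b' = b - S / \<rho>" "1 / b' = b / \<rho>"
    "1 / b = S * (a + S\<^sup>2 - b) - b * S" "S / b = b * (a + S\<^sup>2 - b)"
    "1 / b' = S' * (a + S'\<^sup>2 - b') - b' * S'" "S' / b' = b' * (a + S'\<^sup>2 - b')"
    "b + b' + S * S' = \<rho>^3" "S * b' + S' * b = \<rho>\<^sup>2"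
    using cofactor_relations[OF S2 ab b(1) _ _ r(1) r5] S unfolding S'_def b'_def by auto
  have i: "i * \<rho> = 1" "10000/10300 \<le> i" "i \<le> 1"
    using r b by (simp_all add: i_def field_simps)
  have S': "S' = i - S" "15758/10000 \<le> S'" "S' \<le> 16181/10000"
    using S i by (simp_all add: S'_def i_def)
  \<comment> \<open>\<open>b' = \<rho> / b\<close> is at least 1 / sqrt b because
    \<open>b \<le> \<rho>\<^sup>2\<close>.\<close>
  have b': "985/1000 \<le> b'" "b' \<le> 1" "0 < b'"
  proof -
    have "(985/1000)\<^sup>2 * b\<^sup>2 = b * ((985/1000)\<^sup>2 * b)" by (simp add: power2_eq_square)
    also have "\<dots> \<le> b * 1" using b by (intro mult_left_mono) (auto simp: power2_eq_square)
    also have "\<dots> \<le> \<rho>\<^sup>2" using r by simp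
    finally have "(985/1000 * b)\<^sup>2 \<le> \<rho>\<^sup>2" unfolding power_mult_distrib .
    then have "985/1000 * b \<le> \<rho>" by (rule power2_le_imp_le) (use r in simp)
    then show "985/1000 \<le> b'" "b' \<le> 1" "0 < b'"
      using r(1,3) b(1) by (simp_all add: b'_def pos_le_divide_eq)
  qed
  define Y X M where "Y = b' * \<rho>" and "X = i + Y" and "M = X + S'"
  have Y: "1 \<le> Y" "Y \<le> 103/100"
  proof -
    have "Y * b = \<rho>\<^sup>2" using b by (simp add: Y_def b'_def power2_eq_square)
    then have "1 * b \<le> Y * b" using r by simp
    then show "1 \<le> Y" using b by simp
    have "Y \<le> 1 * \<rho>" unfolding Y_def using b' r by (intro mult_right_mono) auto
    then show "Y \<le> 103/100" using r b by simp
  qed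
  have X: "19708/10000 \<le> X" "X \<le> 203/100" using Y i by (simp_all add: X_def)
  have M: "35466/10000 \<le> M" using X S' by (simp add: M_def)
  have nz: "1 + S + b \<noteq> 0" "1 - S + b \<noteq> 0" "1 + S' + b' \<noteq> 0" "1 - S' + b' \<noteq> 0"
    using b S b' S' by auto
  have energy: "(pair_mode a S b (n + 1))\<^sup>2 - S * pair_mode a S b (n + 1) * pair_mode a S b n + b * (pair_mode a S b n)\<^sup>2
       = b ^ n * a\<^sup>2 / ((1 + b)\<^sup>2 - S\<^sup>2)" for n
    using b nz by (intro pair_mode_energy a rel) auto
  have energy': "(pair_mode a S' b' (n + 1))\<^sup>2 - S' * pair_mode a S' b' (n + 1) * pair_mode a S' b' n + b' * (pair_mode a S' b' n)\<^sup>2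
       = b' ^ n * a\<^sup>2 / ((1 + b')\<^sup>2 - S'\<^sup>2)" for n
    using b' nz by (intro pair_mode_energy a rel) auto
  have bound: "\<bar>dev a (n + 4) - (S\<^sup>2 - b) * dev a (n + 2) + S * b * dev a (n + 1)\<bar> * \<bar>pair_mode a S b (n + 1)\<bar>
       \<le> a / 2 * \<bar>pair_mode a S b (n + 1)\<bar> + 327/500 * a" for n
  proof -
    define \<phi> \<psi> G \<eta> where "\<phi> = pair_mode a S' b' (n + 1)" and "\<psi> = pair_mode a S' b' n"
      and "G = real_mode a \<rho> n" and "\<eta> = pair_mode a S b (n + 1)"
    define d0 d1 d2 d3 d4 where "d0 = dev a (n + 4)" and "d1 = dev a (n + 3)" and "d2 = dev a (n + 2)"
      and "d3 = dev a (n + 1)" and "d4 = dev a n"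
    \<comment> \<open>Applying 1 - S x + b x^2 to \<open>dev\<close> kills the growing pair. The
      quantities \<open>\<phi>\<close>, \<open>\<psi>\<close>, \<open>G\<close> and \<open>J\<close>
      are all combinations of what remains.\<close>
    define k0 k1 k2 where "k0 = d0 - S * d1 + b * d2" and "k1 = d1 - S * d2 + b * d3" and "k2 = d2 - S * d3 + b * d4"
    define J where "J = d0 - (S\<^sup>2 - b) * d2 + S * b * d3"
    have eta': "pair_mode a S' b' m = dev a (m + 3) + S' * dev a (m + 2) + (b - S * i) * dev a (m + 1) + b * i * dev a m" for m
    proof -
      have "dev a m / b' = (1 / b') * dev a m" by simp
      then show ?thesis unfolding pair_mode_def rel(2) rel(3) by (simp add: i_def)
    qed
    have \<phi>: "\<phi> = k0 + i * k1" and \<psi>: "\<psi> = k1 + i * k2"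
      unfolding \<phi>_def \<psi>_def eta'
      unfolding k0_def k1_def k2_def S'(1) d0_def d1_def d2_def d3_def d4_def
      by (simp_all add: algebra_simps numeral_eq_Suc)
    have "b * b' = \<rho>" using b by (simp add: b'_def)
    then have "G = d0 - (S + S') * d1 + (b + b' + S * S') * d2 - (S * b' + S' * b) * d3 + b * b' * d4"
      unfolding rel(8,9) using S'(1) by (simp add: G_def real_mode_def d0_def d1_def d2_def d3_def d4_def i_def)
    then have G: "G = k0 - S' * k1 + b' * k2" by (simp add: k0_def k1_def k2_def algebra_simps)
    have J: "J = k0 + S * k1" by (simp add: J_def k0_def k1_def algebra_simps power2_eq_square)
    \<comment> \<open>The weights \<open>X\<close>, \<open>Y\<close>, \<open>M\<close> come from
      eliminating \<open>k0\<close>, \<open>k1\<close>, \<open>k2\<close>; the last two summands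
      vanish.\<close>
    have "M * J = (X * \<phi> - S' * Y * \<psi>) + S' * G + k1 * (M * (S - i + S')) + S' * b' * k2 * (i * \<rho> - 1)"
      unfolding J G \<phi> \<psi> M_def X_def Y_def by (simp add: algebra_simps)
    then have MJ: "M * J = (X * \<phi> - S' * Y * \<psi>) + S' * G" by (simp add: S'(1) i(1))
    have form: "(X * \<phi> - S' * Y * \<psi>)\<^sup>2 \<le> 33/100 * M\<^sup>2 * (\<phi>\<^sup>2 - S' * \<phi> * \<psi> + b' * \<psi>\<^sup>2)"
      unfolding M_def using X Y S' b' by (intro mode_form_bound) auto
    have "\<phi>\<^sup>2 - S' * \<phi> * \<psi> + b' * \<psi>\<^sup>2 = b' ^ n * a\<^sup>2 / ((1 + b')\<^sup>2 - S'\<^sup>2)"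
      unfolding \<phi>_def \<psi>_def by (rule energy')
    also have "\<dots> \<le> 1 * a\<^sup>2 / (132/100)"
    proof (rule frac_le)
      have "(1985/1000)\<^sup>2 \<le> (1 + b')\<^sup>2" "S'\<^sup>2 \<le> (16181/10000)\<^sup>2" using b' S' by (intro power_mono; simp)+
      then show "132/100 \<le> (1 + b')\<^sup>2 - S'\<^sup>2" by (simp add: power2_eq_square)
      show "b' ^ n * a\<^sup>2 \<le> 1 * a\<^sup>2" using b' by (intro mult_right_mono power_le_one) auto
    qed auto
    finally have "33/100 * M\<^sup>2 * (\<phi>\<^sup>2 - S' * \<phi> * \<psi> + b' * \<psi>\<^sup>2) \<le> 33/100 * M\<^sup>2 * (1 * a\<^sup>2 / (132/100))"
      by (rule mult_left_mono) simp
    also have "\<dots> = (M * a / 2)\<^sup>2" by (simp add: power_mult_distrib power_divide)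
    finally have "(X * \<phi> - S' * Y * \<psi>)\<^sup>2 \<le> (M * a / 2)\<^sup>2" using form by linarith
    then have F: "\<bar>X * \<phi> - S' * Y * \<psi>\<bar> \<le> M * a / 2"
      using M a by (simp add: abs_le_square_iff[symmetric] abs_mult)
    have "\<bar>G\<bar> = i ^ n * \<bar>real_mode a \<rho> 0\<bar>"
      unfolding G_def real_mode_power[OF a(1) r(1) r5, of n] using r by (simp add: abs_mult power_abs i_def)
    also have "\<dots> \<le> i ^ n * (262/100)"
      using real_mode_init[OF a r(1)] r b i by (intro mult_left_mono) auto
    finally have "\<bar>G\<bar>\<^sup>2 \<le> (i ^ n * (262/100))\<^sup>2" by (intro power_mono) auto
    then have "G\<^sup>2 * b ^ n \<le> (i ^ n * (262/100))\<^sup>2 * b ^ n"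
      using b by (intro mult_right_mono) simp_all
    also have "\<dots> = (262/100)\<^sup>2 * ((i\<^sup>2 * b) ^ n)"
    proof -
      have "(i ^ n)\<^sup>2 = (i\<^sup>2) ^ n" by (simp add: mult.commute flip: power_mult)
      then show ?thesis unfolding power_mult_distrib by simp
    qed
    finally have G2: "G\<^sup>2 * b ^ n \<le> (262/100)\<^sup>2 * ((i\<^sup>2 * b) ^ n)" .
    have "i\<^sup>2 * b \<le> i\<^sup>2 * \<rho>\<^sup>2" using r by (intro mult_left_mono) auto
    also have "\<dots> = 1" using i(1) by (simp flip: power_mult_distrib)
    finally have "(i\<^sup>2 * b) ^ n \<le> 1" using i b by (intro power_le_one) auto
    then have "(262/100)\<^sup>2 * (i\<^sup>2 * b) ^ n \<le> (262/100)\<^sup>2" by (rule mult_left_le) simp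
    with G2 have G3: "G\<^sup>2 * b ^ n \<le> (262/100)\<^sup>2" by (rule order_trans)
    define z where "z = pair_mode a S b n"
    \<comment> \<open>Completing the square in \<open>z\<close>: the energy is at least
      \<open>(1 - S\<^sup>2 / (4 * b)) * \<eta>\<^sup>2\<close>, whence 904/1000.\<close>
    have "b * z\<^sup>2 - S * \<eta> * z = b * (z - S * \<eta> / (2 * b))\<^sup>2 - S\<^sup>2 / (4 * b) * \<eta>\<^sup>2"
      using b by (simp add: field_simps power2_eq_square)
    moreover have "0 \<le> b * (z - S * \<eta> / (2 * b))\<^sup>2" using b by simp
    moreover have "S\<^sup>2 / (4 * b) * \<eta>\<^sup>2 \<le> (96/1000) * \<eta>\<^sup>2"
    proof (rule mult_right_mono)
      have "\<bar>S\<bar>\<^sup>2 \<le> (6181/10000)\<^sup>2" using S by (intro power_mono) auto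
      then have "S\<^sup>2 \<le> (96/1000) * (4 * b)" using b by (simp add: power_divide)
      then show "S\<^sup>2 / (4 * b) \<le> 96/1000" using b by (simp add: field_simps)
    qed simp
    moreover have "\<eta>\<^sup>2 - S * \<eta> * z + b * z\<^sup>2 = b ^ n * a\<^sup>2 / ((1 + b)\<^sup>2 - S\<^sup>2)"
      unfolding \<eta>_def z_def by (rule energy)
    ultimately have "(904/1000) * \<eta>\<^sup>2 \<le> b ^ n * a\<^sup>2 / ((1 + b)\<^sup>2 - S\<^sup>2)" by linarith
    also have "\<dots> \<le> b ^ n * a\<^sup>2 / (3617/1000)"
    proof (rule divide_left_mono)
      have "2\<^sup>2 \<le> (1 + b)\<^sup>2" "\<bar>S\<bar>\<^sup>2 \<le> (6181/10000)\<^sup>2" using b S by (intro power_mono; simp)+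
      then show g: "3617/1000 \<le> (1 + b)\<^sup>2 - S\<^sup>2" by (simp add: power_divide)
      then show "0 < ((1 + b)\<^sup>2 - S\<^sup>2) * (3617/1000)" by simp
    qed (use b in simp)
    finally have e: "(904/1000) * (3617/1000) * \<eta>\<^sup>2 \<le> b ^ n * a\<^sup>2" by simp
    have "(904/1000) * (3617/1000) * (G * \<eta>)\<^sup>2 = G\<^sup>2 * ((904/1000) * (3617/1000) * \<eta>\<^sup>2)"
      by (simp add: power_mult_distrib)
    also have "\<dots> \<le> G\<^sup>2 * (b ^ n * a\<^sup>2)" using e by (intro mult_left_mono) auto
    also have "\<dots> = (G\<^sup>2 * b ^ n) * a\<^sup>2" by simp
    also have "\<dots> \<le> (262/100)\<^sup>2 * a\<^sup>2" using G3 by (intro mult_right_mono) auto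
    also have "\<dots> \<le> (904/1000) * (3617/1000) * (145/100 * a)\<^sup>2" by (simp add: power_mult_distrib power_divide)
    finally have "(G * \<eta>)\<^sup>2 \<le> (145/100 * a)\<^sup>2" by simp
    then have Ge: "\<bar>G\<bar> * \<bar>\<eta>\<bar> \<le> 145/100 * a"
      using a abs_le_square_iff[of "G * \<eta>" "145/100 * a"] by (simp add: abs_mult)
    have SM: "S' \<le> 451/1000 * M" using S' X by (simp add: M_def)
    have "M * (\<bar>J\<bar> * \<bar>\<eta>\<bar>) = \<bar>M * J\<bar> * \<bar>\<eta>\<bar>" using M by (simp add: abs_mult)
    also have "\<dots> \<le> (M * a / 2 + S' * \<bar>G\<bar>) * \<bar>\<eta>\<bar>"
      using F S' unfolding MJ by (intro mult_right_mono abs_triangle_ineq[THEN order_trans] add_mono) (auto simp: abs_mult)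
    finally have 1: "M * (\<bar>J\<bar> * \<bar>\<eta>\<bar>) \<le> M * (a / 2 * \<bar>\<eta>\<bar>) + S' * (\<bar>G\<bar> * \<bar>\<eta>\<bar>)"
      by (simp add: algebra_simps)
    have "S' * (\<bar>G\<bar> * \<bar>\<eta>\<bar>) \<le> (451/1000 * M) * (145/100 * a)"
      by (rule mult_mono[OF SM Ge]) (use M in auto)
    also have "\<dots> \<le> M * (327/500 * a)" using M a by simp
    finally have "M * (\<bar>J\<bar> * \<bar>\<eta>\<bar>) \<le> M * (a / 2 * \<bar>\<eta>\<bar> + 327/500 * a)"
      using 1 by (simp add: distrib_left)
    then have "\<bar>J\<bar> * \<bar>\<eta>\<bar> \<le> a / 2 * \<bar>\<eta>\<bar> + 327/500 * a" using M by (simp only: mult_le_cancel_left)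
    then show ?thesis by (simp add: J_def \<eta>_def d0_def d2_def d3_def)
  qed
  show ?thesis using that[of b S] b S rel(1) energy bound by blast
qed

section \<open>Negativity and separation for \<open>a \<le> 7/100\<close>\<close>

lemma tail_le_1:
  assumes "0 \<le> a" "\<forall>k<K. 0 \<le> tail a k" "k < K"
  shows "tail a k \<le> 1"
proof (cases "5 \<le> k")
  case True
  then have "0 \<le> a * tail a (k - 2)" "0 \<le> tail a (k - 5)" using assms by auto
  then show ?thesis using tail_rec[OF True, of a] by linarith
next
  case False
  then have "k = 0 \<or> k = 1 \<or> k = 2 \<or> k = 3 \<or> k = 4" by auto
  then show ?thesis by (auto simp: numeral_eq_Suc)
qed

text \<open>Otherwise all terms lie in [0, 1] and \<open>pair_mode\<close> is bounded, while its
  energy grows like \<open>b ^ n\<close> with \<open>b > 1\<close>.\<close>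

lemma tail_negative_small:
  assumes a: "0 < a" "a \<le> 7/100"
  shows "\<exists>k. tail a k < 0"
proof (rule ccontr)
  assume "\<not> ?thesis"
  then have nn: "0 \<le> tail a k" for k by (auto simp: not_less)
  have le1: "tail a k \<le> 1" for k using tail_le_1[of a "Suc k" k] nn a by simp
  obtain b S where b: "1 < b" "b \<le> 103/100" and S: "- 6181/10000 \<le> S" "S \<le> - 605/1000"
    and q: "a + S\<^sup>2 - b = S / b\<^sup>2"
    and energy: "\<And>n. (pair_mode a S b (n + 1))\<^sup>2 - S * pair_mode a S b (n + 1) * pair_mode a S b n + b * (pair_mode a S b n)\<^sup>2
       = b ^ n * a\<^sup>2 / ((1 + b)\<^sup>2 - S\<^sup>2)"
    using modal_bound[OF a] by metis
  have d: "\<bar>dev a k\<bar> \<le> 1" for k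
  proof -
    have "0 < 1 / (2 + a)" "1 / (2 + a) \<le> 1" using a by simp_all
    then show ?thesis using nn[of k] le1[of k] unfolding dev_def by linarith
  qed
  have S1: "\<bar>S\<bar> \<le> 1" using S by simp
  have b1: "1 \<le> b\<^sup>2" using b by (intro one_le_power) auto
  have prod: "\<bar>x * dev a k\<bar> \<le> 1" if "\<bar>x\<bar> \<le> 1" for x k
    unfolding abs_mult using mult_mono[OF that d[of k]] by simp
  have "\<bar>S / b\<^sup>2\<bar> \<le> 1" "\<bar>1 / b\<bar> \<le> 1"
    using order_trans[OF S1 b1] b by (simp_all add: abs_divide divide_le_eq)
  note small = this
  have e: "\<bar>pair_mode a S b n\<bar> \<le> 4" for n
  proof -
    have "pair_mode a S b n = dev a (n + 3) + S * dev a (n + 2) + S / b\<^sup>2 * dev a (n + 1) + 1 / b * dev a n"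
      unfolding pair_mode_def q by simp
    then show ?thesis
      using prod[OF S1, of "n + 2"] prod[OF small(1), of "n + 1"] prod[OF small(2), of n] d[of "n + 3"]
      by linarith
  qed
  have bd: "b ^ n \<le> 100 * 5 / a\<^sup>2" for n
  proof -
    let ?x = "pair_mode a S b (n + 1)" and ?y = "pair_mode a S b n"
    have "\<bar>?x\<bar>\<^sup>2 \<le> 4\<^sup>2" "\<bar>?y\<bar>\<^sup>2 \<le> 4\<^sup>2" using e[of "n + 1"] e[of n] by (intro power_mono; simp)+
    then have sq: "?x\<^sup>2 \<le> 16" "?y\<^sup>2 \<le> 16" by simp_all
    have "\<bar>S\<bar> * \<bar>?x\<bar> * \<bar>?y\<bar> \<le> 1 * 4 * 4" using e[of "n + 1"] e[of n] S1 by (intro mult_mono) auto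
    then have "- (S * ?x * ?y) \<le> 16" using abs_ge_minus_self[of "S * ?x * ?y"] by (simp add: abs_mult)
    moreover have "b * ?y\<^sup>2 \<le> 2 * 16" using b sq by (intro mult_mono) auto
    ultimately have "b ^ n * a\<^sup>2 / ((1 + b)\<^sup>2 - S\<^sup>2) \<le> 100" using energy[of n] sq by linarith
    moreover have "2\<^sup>2 \<le> (1 + b)\<^sup>2" "(1 + b)\<^sup>2 \<le> (203/100)\<^sup>2" "\<bar>S\<bar>\<^sup>2 \<le> 1\<^sup>2"
      using b S by (intro power_mono; simp)+
    then have "0 < (1 + b)\<^sup>2 - S\<^sup>2" "(1 + b)\<^sup>2 \<le> 5" by (simp_all add: power_divide)
    moreover from this have "(1 + b)\<^sup>2 - S\<^sup>2 \<le> 5" using zero_le_power2[of S] by linarith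
    ultimately have "b ^ n * a\<^sup>2 \<le> 100 * 5" by (simp add: divide_le_eq)
    then show ?thesis using a by (simp add: le_divide_eq)
  qed
  obtain n where "100 * 5 / a\<^sup>2 < b ^ n" using real_arch_pow[OF b(1)] by blast
  then show False using bd[of n] by simp
qed

text \<open>At a double zero \<open>J\<close> depends on \<open>u\<close> alone. Either failure
  pushes \<open>u\<close> so far from its forced value that \<open>J\<close> and
  \<open>\<eta>\<close> are too large for \<open>modal_bound\<close>.\<close>

lemma separated_small:
  assumes a: "0 < a" "a \<le> 7/100" and K: "14 \<le> K" and nn: "\<forall>k<K. 0 \<le> tail a k"
  shows "separated a K"
  unfolding separated_def
proof (intro impI)
  assume z: "tail a (K - 2) = 0" "tail a (K - 5) = 0"
  define n where "n = K - 6"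
  then have n: "K = n + 6" using K by simp
  obtain b S where b: "1 < b" "b \<le> 103/100" and S: "- 6181/10000 \<le> S" "S \<le> - 605/1000"
    and q: "a + S\<^sup>2 - b = S / b\<^sup>2"
    and bd: "\<And>n. \<bar>dev a (n + 4) - (S\<^sup>2 - b) * dev a (n + 2) + S * b * dev a (n + 1)\<bar> * \<bar>pair_mode a S b (n + 1)\<bar>
       \<le> a / 2 * \<bar>pair_mode a S b (n + 1)\<bar> + 327/500 * a"
    using modal_bound[OF a] by metis
  define h u v w where "h = 1 / (2 + a)" and "u = tail a (K - 4)" and "v = tail a (K - 3)" and "w = tail a (K - 1)"
  have h: "48309/100000 \<le> h" "h \<le> 1/2 - 2415/10000 * a"
  proof -
    show "48309/100000 \<le> h" using a by (simp add: h_def field_simps)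
    have "a * (4830 * a) \<le> a * 340" using a by (intro mult_left_mono) auto
    then show "h \<le> 1/2 - 2415/10000 * a" using a by (simp add: h_def field_simps)
  qed
  have uvw: "0 \<le> u" "0 \<le> v" "0 \<le> w" "w \<le> 1"
    using nn K tail_le_1[OF _ nn, of "K - 1"] a by (simp_all add: u_def v_def w_def)
  define J \<eta> where "J = - h * (1 + S * b) + (b - S\<^sup>2) * (u - h)" and "\<eta> = pair_mode a S b (n + 1)"
  have d: "dev a (n + 4) = - h" "dev a (n + 3) = v - h" "dev a (n + 2) = u - h" "dev a (n + 1) = - h"
    using z by (simp_all add: dev_def h_def u_def v_def n add.commute)
  have "dev a (n + 4) - (S\<^sup>2 - b) * dev a (n + 2) + S * b * dev a (n + 1) = J"
    unfolding d by (simp add: J_def algebra_simps)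
  then have Jbd: "(\<bar>J\<bar> - a / 2) * \<bar>\<eta>\<bar> \<le> 327/500 * a" using bd[of n] by (simp add: \<eta>_def algebra_simps)
  \<comment> \<open>As \<open>S < 0\<close>, the contributions of \<open>h\<close>, \<open>u\<close>
    and \<open>v\<close> to \<open>- \<eta>\<close> all have the same sign.\<close>
  have e: "7346/10000 * h + 57/100 * u \<le> \<bar>\<eta>\<bar>"
  proof -
    define c where "c = 1 / b"
    have c: "10000/10300 \<le> c" "c \<le> 1" using b by (simp_all add: c_def field_simps)
    have c2: "c\<^sup>2 \<le> 1\<^sup>2" "(10000/10300)\<^sup>2 \<le> c\<^sup>2" using c by (intro power_mono; simp)+
    have eq: "\<eta> = - h + S * (v - h) + S * c\<^sup>2 * (u - h) - h * c"
      unfolding \<eta>_def pair_mode_def q using d by (simp add: c_def power_one_over numeral_eq_Suc divide_inverse)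
    have "(6181/10000) * (1 + c\<^sup>2) \<le> (6181/10000) * 2" using c2 by simp
    moreover have "(- S) * (1 + c\<^sup>2) \<le> (6181/10000) * (1 + c\<^sup>2)" using S c2 by (intro mult_right_mono) auto
    ultimately have "7346/10000 \<le> 1 + c + S * (1 + c\<^sup>2)" using c by simp
    then have 1: "7346/10000 * h \<le> (1 + c + S * (1 + c\<^sup>2)) * h" using h by (intro mult_right_mono) auto
    have "(605/1000) * (10000/10300)\<^sup>2 \<le> (- S) * c\<^sup>2" using S c2 by (intro mult_mono) auto
    then have "57/100 \<le> (- S) * c\<^sup>2" by (simp add: power_divide)
    then have 2: "57/100 * u \<le> (- S) * c\<^sup>2 * u" using uvw by (intro mult_right_mono) auto
    have 3: "0 \<le> (- S) * v" using S uvw by (intro mult_nonneg_nonneg) auto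
    have "- \<eta> = (1 + c + S * (1 + c\<^sup>2)) * h + (- S) * v + (- S) * c\<^sup>2 * u" unfolding eq by (simp add: algebra_simps)
    then show ?thesis using 1 2 3 by linarith
  qed
  have gap: False if "x \<le> \<bar>J\<bar> - a / 2" "y \<le> \<bar>\<eta>\<bar>" "0 \<le> x" "0 \<le> y" "327/500 * a < x * y" for x y
    using mult_mono[OF that(1,2)] that Jbd by linarith
  have S2: "\<bar>S\<bar>\<^sup>2 \<le> (6181/10000)\<^sup>2" "(605/1000)\<^sup>2 \<le> \<bar>S\<bar>\<^sup>2" using S by (intro power_mono; simp)+
  have "u + a * w < 1"
  proof (rule ccontr)
    assume "\<not> ?thesis"
    moreover have "a * w \<le> a * 1" using a uvw by (intro mult_left_mono) auto
    ultimately have u: "1 - a \<le> u" by linarith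
    \<comment> \<open>1605/1000 is the lower bound for \<open>1 - S\<close>; \<open>t\<close> arises
      by taking \<open>1 + S\<close> out of \<open>J\<close> at \<open>b = 1\<close>.\<close>
    define t where "t = - h + (1605/1000) * (u - h)"
    have t: "3025/10000 - 9759/10000 * a \<le> t"
    proof -
      have "t = 1605/1000 * u - 2605/1000 * h" by (simp add: t_def field_simps)
      then show ?thesis using u h a by linarith
    qed
    have "(1 + S) * t \<le> (1 + S) * (- h + (1 - S) * (u - h))"
      unfolding t_def using S u h a by (intro mult_left_mono add_left_mono mult_right_mono) auto
    also have "\<dots> = - h * (1 + S) + (1 - S\<^sup>2) * (u - h)" by (simp add: algebra_simps power2_eq_square)
    also have "\<dots> \<le> J"
    proof -
      have "h * (1 + S * b) \<le> h * (1 + S)" using S b h by (intro mult_left_mono) auto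
      moreover have "(1 - S\<^sup>2) * (u - h) \<le> (b - S\<^sup>2) * (u - h)" using b u h a by (intro mult_right_mono) auto
      ultimately show ?thesis by (simp add: J_def)
    qed
    finally have "(1 + S) * t \<le> J" .
    moreover have "(3819/10000) * (3025/10000 - 9759/10000 * a) \<le> (1 + S) * t"
      using S t a by (intro mult_mono) auto
    moreover have "(3819/10000) * (3025/10000 - 9759/10000 * a) = 11552475/100000000 - 37269621/100000000 * a"
      by (simp add: field_simps)
    ultimately have 1: "1155/10000 - 8728/10000 * a \<le> \<bar>J\<bar> - a / 2" using a by linarith
    have 2: "8849/10000 \<le> \<bar>\<eta>\<bar>" using e h u a by linarith
    show False by (rule gap[OF 1 2]) (use a in \<open>simp_all add: field_simps\<close>)
  qed
  moreover have "1 + a < 2 * u + 3 * a * w"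
  proof (rule ccontr)
    assume "\<not> ?thesis"
    moreover have "0 \<le> a * w" using a uvw by simp
    ultimately have u2: "2 * u \<le> 1 + a" by linarith
    \<comment> \<open>The zero at \<open>K - 2\<close>, with the recurrence at \<open>K - 2\<close>
      and \<open>K - 7\<close>, gives \<open>tail a (K - 9) \<le> u\<close>; the recurrence at
      \<open>K - 4\<close> then gives \<open>1 - a \<le> 2 * u\<close>.\<close>
    have u1: "(1 - a) / 2 \<le> u"
    proof -
      have "tail a (K - 2) = 1 - a * u - tail a (K - 7)" "tail a (K - 7) = 1 - a * tail a (K - 9) - tail a (K - 12)"
        "u = 1 - a * tail a (K - 6) - tail a (K - 9)"
        using tail_rec[of "K - 2" a] tail_rec[of "K - 7" a] tail_rec[of "K - 4" a] K by (simp_all add: u_def)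
      moreover have "0 \<le> tail a (K - 12)" "a * tail a (K - 6) \<le> a * 1"
        using nn K a tail_le_1[OF _ nn, of "K - 6"] by (auto intro!: mult_left_mono)
      ultimately have "a * tail a (K - 9) \<le> a * u" "1 - a \<le> u + tail a (K - 9)" using z by linarith+
      then show ?thesis using a by simp
    qed
    have "J \<le> - (48309/100000) * (3633/10000) + (664/1000) * (52/1000)"
    proof -
      have "- S * b \<le> (6181/10000) * (103/100)" using S b by (intro mult_mono) auto
      then have "(48309/100000) * (3633/10000) \<le> h * (1 + S * b)" using h by (intro mult_mono) auto
      moreover have "(b - S\<^sup>2) * (u - h) \<le> (b - S\<^sup>2) * (52/1000)"
        using u2 h a S2 b by (intro mult_left_mono) (auto simp: power_divide)
      moreover have "(b - S\<^sup>2) * (52/1000) \<le> (664/1000) * (52/1000)"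
        using S2 b by (intro mult_right_mono) (auto simp: power_divide)
      ultimately show ?thesis unfolding J_def by linarith
    qed
    then have 1: "104/1000 \<le> \<bar>J\<bar> - a / 2" using a by linarith
    have "465/1000 \<le> u" using u1 a by (simp add: field_simps)
    then have 2: "6198/10000 \<le> \<bar>\<eta>\<bar>" using e h by linarith
    show False by (rule gap[OF 1 2]) (use a in \<open>simp_all add: field_simps\<close>)
  qed
  ultimately show "1 + a < 2 * tail a (K - 4) + 3 * a * tail a (K - 1) \<and> tail a (K - 4) + a * tail a (K - 1) < 1"
    by (simp add: u_def w_def)
qed

section \<open>The theorem\<close>

text \<open>For \<open>a > 1/2\<close> the term at index 13 is negative, so no
  \<open>K \<ge> 14\<close> meets the guard.\<close>

lemma tail_core:
  assumes a: "0 < a" "a < 1"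
  shows "(\<exists>k. tail a k < 0) \<and> (\<forall>K\<ge>14. (\<forall>k<K. 0 \<le> tail a k) \<longrightarrow> separated a K)"
proof -
  consider "a \<le> 7/100" | "573 \<le> 8192 * a" "8192 * a \<le> 4096" | "1/2 < a" by linarith
  then show ?thesis
  proof cases
    case 1
    then show ?thesis using tail_negative_small separated_small a by blast
  next
    case 2
    then have "settled a 5" by (rule settled_mid)
    then show ?thesis unfolding settled_def by auto
  next
    case 3
    have "tail a 13 = a * (1 - 2 * a)" by (simp add: numeral_eq_Suc algebra_simps)
    also have "\<dots> < 0" using 3 by (intro mult_pos_neg) auto
    finally have *: "tail a 13 < 0" .
    then have "\<not> (\<forall>k<K. 0 \<le> tail a k)" if "14 \<le> K" for K
      using that by (intro notI) (auto dest!: spec[of _ 13])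
    then show ?thesis using * by blast
  qed
qed

section \<open>From the power series to \<open>tail\<close>\<close>

lemma coeff_recurrence:
  fixes a :: real
  assumes "(fps_X ^ 5 + fps_const a * fps_X ^ 2 + 1) * Abs_fps b = Abs_fps c"
  shows "(if n < 5 then 0 else b (n - 5)) + a * (if n < 2 then 0 else b (n - 2)) + b n = c n"
proof -
  have "fps_nth ((fps_X ^ 5 + fps_const a * fps_X ^ 2 + 1) * Abs_fps b) n = c n"
    unfolding assms by simp
  then show ?thesis by (auto simp: distrib_right mult.assoc fps_X_power_mult_nth split: if_splits)
qed

theorem theorem1p6:
  fixes a :: real and b c :: "nat \<Rightarrow> real"
  assumes "0 < a" and "a < 1"
    and "\<And>k. c k \<in> {0, 1}"
    and "c 0 = 1"
    and "(fps_X ^ 5 + fps_const a * fps_X ^ 2 + 1) * Abs_fps b = Abs_fps c"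
  shows "\<exists>n. b n < 0 \<and> enat n \<le> first_zero_ge4 c + 8"
proof (rule ccontr)
  assume "\<not> ?thesis"
  then have nonneg: "0 \<le> b n" if "enat n \<le> first_zero_ge4 c + 8" for n
    using that by (auto simp: not_less)
  have c01: "c k = 0 \<or> c k = 1" for k using assms(3)[of k] by simp
  note co = coeff_recurrence[OF assms(5)]
  have rec: "b n = c n - a * b (n - 2) - b (n - 5)" if "5 \<le> n" for n
    using co[of n] that by simp
  have fz: "4 \<le> first_zero_ge4 c"
  proof (cases "\<exists>n\<ge>4. c n = 0")
    case True
    then have "4 \<le> (LEAST n. 4 \<le> n \<and> c n = 0)" by (metis (mono_tags, lifting) LeastI_ex)
    then show ?thesis using True by (simp add: first_zero_ge4_def numeral_eq_enat)
  qed (auto simp: first_zero_ge4_def)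
  have n12: "0 \<le> b n" if "n \<le> 12" for n
  proof (rule nonneg)
    have "enat n \<le> 4 + 8" using that by (simp add: numeral_eq_enat)
    also have "\<dots> \<le> first_zero_ge4 c + 8" using fz by (rule add_right_mono)
    finally show "enat n \<le> first_zero_ge4 c + 8" .
  qed
  have b0: "b 0 = 1" and b1: "b 1 = c 1" using co[of 0] co[of 1] assms(4) by simp_all
  have "b 2 = c 2 - a" using co[of 2] b0 by simp
  then have b2: "b 2 = 1 - a" using c01[of 2] n12[of 2] assms(1) by auto
  have b3: "b 3 = c 3 - a * c 1" using co[of 3] b1 by simp
  have "b 4 = c 4 - a * b 2" using co[of 4] by simp
  moreover have pos: "0 < a * b 2" "a * b 2 < 1"
    using assms(1,2) mult_strict_mono[of a 1 "1 - a" 1] by (simp_all add: b2)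
  ultimately have c4: "c 4 = 1" and b4: "b 4 = 1 - a * b 2" "0 < b 4" using c01[of 4] n12[of 4] by auto
  have "b 5 = c 5 - a * b 3 - 1" using rec[of 5] b0 by simp
  then have "a * b 3 \<le> 0" using c01[of 5] n12[of 5] n12[of 3] assms(1) by auto
  then have "b 3 = 0" using n12[of 3] assms(1) by (auto simp: mult_le_0_iff)
  \<comment> \<open>\<open>c 3 = a * c 1\<close> with both in {0, 1} and
    \<open>0 < a < 1\<close>.\<close>
  then have c13: "c 1 = 0" "c 3 = 0" using b3 c01[of 1] c01[of 3] assms(1,2) by auto
  \<comment> \<open>The four virtual values 1, 0, 1, 0 before \<open>b 0\<close> let the recurrence
    with constant term 1 also produce \<open>b 1\<close>, ..., \<open>b 4\<close>, although
    \<open>c 1 = c 3 = 0\<close>.\<close>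
  have b_tail: "b n = tail a (n + 4)" if "n < M" "\<forall>k. 4 \<le> k \<longrightarrow> k < M \<longrightarrow> c k = 1" for n M
    using that(1)
  proof (induction n rule: less_induct)
    case (less n)
    consider "n = 0" | "n = 1" | "n = 2" | "n = 3" | "n = 4" | "5 \<le> n" by linarith
    then show ?case
    proof cases
      case 6
      have "b n = 1 - a * b (n - 2) - b (n - 5)" using rec[OF 6] that(2) less.prems 6 by simp
      also have "\<dots> = 1 - a * tail a (n - 2 + 4) - tail a (n - 5 + 4)" using less.IH less.prems 6 by simp
      also have "n - 2 + 4 = n + 4 - 2" using 6 by simp
      also have "n - 5 + 4 = n + 4 - 5" using 6 by simp
      also have "1 - a * tail a (n + 4 - 2) - tail a (n + 4 - 5) = tail a (n + 4)"
        using 6 by (intro tail_rec[symmetric]) simp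
      finally show ?thesis .
    qed (use b0 b1 b2 b3 b4 c13 in \<open>simp_all add: numeral_eq_Suc\<close>)
  qed
  note core = tail_core[OF assms(1,2)]
  show False
  proof (cases "\<exists>n\<ge>4. c n = 0")
    case False
    then have "c k = 1" if "4 \<le> k" for k using c01[of k] that by blast
    then have "b n = tail a (n + 4)" for n using b_tail[of n "Suc n"] by simp
    moreover have "0 \<le> b n" for n using False by (intro nonneg) (auto simp: first_zero_ge4_def)
    ultimately have "0 \<le> tail a (n + 4)" for n by metis
    moreover have "0 \<le> tail a k" if "k < 4" for k
    proof -
      have "k = 0 \<or> k = 1 \<or> k = 2 \<or> k = 3" using that by auto
      then show ?thesis by (auto simp: numeral_eq_Suc)
    qed
    ultimately have "0 \<le> tail a k" for k by (metis add.commute le_Suc_ex not_less)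
    then show False using core by (meson not_less)
  next
    case True
    define N where "N = (LEAST n. 4 \<le> n \<and> c n = 0)"
    have N: "4 \<le> N" "c N = 0"
      using LeastI_ex[of "\<lambda>n. 4 \<le> n \<and> c n = 0"] True unfolding N_def by blast+
    have c1: "\<forall>k. 4 \<le> k \<longrightarrow> k < N \<longrightarrow> c k = 1"
      using not_less_Least[of _ "\<lambda>n. 4 \<le> n \<and> c n = 0"] c01 unfolding N_def by blast
    have nn: "0 \<le> b n" if "n \<le> N + 8" for n
      using that True by (intro nonneg) (simp add: first_zero_ge4_def N_def numeral_eq_enat)
    have N5: "5 \<le> N" using N c4 by (cases "N = 4") auto
    have bN: "b N = - (a * b (N - 2)) - b (N - 5)" using rec[OF N5] N by simp
    have "0 \<le> a * b (N - 2)" using nn assms(1) by simp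
    then have "a * b (N - 2) = 0" and z5: "b (N - 5) = 0" using bN nn[of N] nn[of "N - 5"] by linarith+
    then have z2: "b (N - 2) = 0" using assms(1) by simp
    have z: "b N = 0" using bN z2 z5 by simp
    \<comment> \<open>This gives \<open>K \<ge> 14\<close>. For \<open>N\<close> = 5, ..., 9 a
      forced zero would fall on \<open>b 0\<close>, \<open>b 4\<close>, \<open>b 2\<close>,
      \<open>b 6\<close>, \<open>b 4\<close> respectively, all positive.\<close>
    have N10: "10 \<le> N"
    proof (rule ccontr)
      assume "\<not> ?thesis"
      then consider "N = 5" | "N = 6" | "N = 7" | "N = 8" | "N = 9" using N5 by linarith
      then show False
      proof cases
        case 4
        have "b 6 = 1 - a * b 4" using rec[of 6] c1 4 b1 c13 by simp
        moreover have "a * b 4 < 1" using mult_strict_mono[of a 1 "b 4" 1] assms(1,2) b4 pos by simp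
        ultimately show False using z2 4 by simp
      qed (use z2 z5 b0 b2 b4 assms(2) in simp_all)
    qed
    define K where "K = N + 4"
    have bK: "b n = tail a (n + 4)" if "n < N" for n using b_tail[OF that c1] .
    have "0 \<le> tail a k" if "k < K" for k
    proof (cases "4 \<le> k")
      case True
      then show ?thesis using bK[of "k - 4"] nn[of "k - 4"] that by (simp add: K_def)
    next
      case False
      then have "k = 0 \<or> k = 1 \<or> k = 2 \<or> k = 3" by auto
      then show ?thesis by (auto simp: numeral_eq_Suc)
    qed
    then have cl: "separated a K" using core N10 by (simp add: K_def)
    define u w y where "u = b (N - 4)" and "w = b (N - 1)" and "y = b (N + 1)"
    have "tail a (K - 2) = 0" "tail a (K - 5) = 0" "u = tail a (K - 4)" "w = tail a (K - 1)"
      using bK[of "N - 2"] bK[of "N - 5"] bK[of "N - 4"] bK[of "N - 1"] N10 z2 z5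
      by (simp_all add: K_def u_def w_def)
    then have claim: "1 + a < 2 * u + 3 * a * w" "u + a * w < 1" using cl by (simp_all add: separated_def)
    have r: "b (N + 1) = c (N + 1) - a * w - u" "b (N + 3) = c (N + 3) - a * y - b (N - 2)"
      "b (N + 4) = c (N + 4) - a * b (N + 2) - w" "b (N + 6) = c (N + 6) - a * b (N + 4) - y"
      "b (N + 8) = c (N + 8) - a * b (N + 6) - b (N + 3)"
      using rec[of "N + 1"] rec[of "N + 3"] rec[of "N + 4"] rec[of "N + 6"] rec[of "N + 8"] N10
      by (simp_all add: u_def w_def y_def add.commute numeral_2_eq_2)
    have p: "0 \<le> u" "0 \<le> w" "0 \<le> y" "0 \<le> b (N + 2)" "0 \<le> b (N + 3)" "0 \<le> b (N + 4)" "0 \<le> b (N + 6)" "0 \<le> b (N + 8)"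
      using nn by (simp_all add: u_def w_def y_def)
    have ap: "0 \<le> a * w" "0 \<le> a * b (N + 2)" "0 \<le> a * b (N + 4)" "0 \<le> a * b (N + 6)" using p assms(1) by simp_all
    have "c (N + 1) = 1"
    proof (rule ccontr)
      assume "\<not> ?thesis"
      then have "y = - (a * w) - u" using c01[of "N + 1"] r(1) by (simp add: y_def)
      then have "a * w = 0" "u = 0" using p(1,3) ap(1) by linarith+
      then have "2 * u + 3 * a * w = 0" by simp
      then show False using claim(1) assms(1) by linarith
    qed
    then have y: "y = 1 - a * w - u" "0 < y" using r(1) claim(2) by (simp_all add: y_def)
    have "y \<le> 1" using y(1) p(1) ap(1) by linarith
    then have "a * y \<le> a * 1" using assms(1) by (intro mult_left_mono) auto
    then have "a * y < 1" using assms(2) by linarith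
    moreover have "0 < a * y" using assms(1) y(2) by simp
    ultimately have ay: "0 < a * y" "a * y < 1" by simp_all
    have b3': "b (N + 3) = 1 - a * y" using r(2) z2 c01[of "N + 3"] p(5) ay by auto
    \<comment> \<open>Here the bound \<open>N + 8\<close> enters: it gives
      \<open>b (N + 6) \<le> y\<close>. With \<open>b (N + 6) = 1 - a * b (N + 4) - y\<close> and
      \<open>b (N + 4) \<le> 1 - w\<close> this becomes
      \<open>2 * u + 3 * a * w \<le> 1 + a\<close>, against \<open>claim\<close>.\<close>
    have "c (N + 8) = 1" using r(5) c01[of "N + 8"] p(8) ap(4) b3' ay by auto
    then have "a * b (N + 6) \<le> a * y" using r(5) p(8) b3' by simp
    then have le: "b (N + 6) \<le> y" using assms(1) by simp
    have "c (N + 6) = 1" using r(4) c01[of "N + 6"] p(7) ap(3) y(2) by auto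
    then have "1 \<le> 2 * y + a * b (N + 4)" using r(4) le by simp
    moreover have "a * b (N + 4) \<le> a * (1 - w)"
      using r(3) c01[of "N + 4"] ap(2) assms(1) by (intro mult_left_mono) auto
    ultimately show False using y(1) claim(1) by (simp add: algebra_simps)
  qed
qed

end
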